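(* Let $\Gamma$ be a sequent provable in $\mathbf{LK}^*$ plus the cut rule. Then there is a sub-multiset $\Gamma'$ of $\Gamma$ that is provable in $\mathbf{LK}^*$ (without cut).
   Context: Formulae of classical propositional logic: $A ::= a \mid \bar a \mid \top \mid \bot \mid A\land A \mid A\lor A$ ($a$ a proposition symbol; $a,\bar a$ dual atoms); $\bar A$ denotes the De Morgan dual of $A$. A sequent is a finite multiset of formulae (more precisely a finite forest of formulae, so that distinct occurrences are distinguished but not ordered). The one-sided sequent calculus $\mathbf{LK}^*$ has axioms $a,\bar a$ (for each proposition symbol $a$) and $\top$, and the rules: - $\lor$: from $\Gamma,A,B$ infer $\Gamma,A\lor B$; - $\lor_0$: from $\Gamma,A$ infer $\Gamma,A\lor B$; - $\lor_1$: from $\Gamma,B$ infer $\Gamma,A\lor B$; - $\land$: from $\Gamma,A$ and $\Delta,B$ infer $\Gamma,\Delta,A\land B$; - mix: from $\Gamma$ and $\Delta$ infer $\Gamma,\Delta$; - contraction: from $\Gamma,C,C$ infer $\Gamma,C$, only when $C$ is an atom ($a$ or $\bar a$) or a conjunction $A\land B$. There is no weakening rule. The cut rule: from $\Gamma,A$ and $\Delta,\bar A$ infer $\Gamma,\Delta$. *)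

theory Defs
  imports "HOL-Library.Multiset"
begin

datatype 'a form =
    Pos 'a
  | Neg 'a  \<comment> \<open>the dual atom of \<open>Pos\<close>, not a connective\<close>
  | Verum
  | Falsum
  | Conj "'a form" "'a form"
  | Disj "'a form" "'a form"

primrec dual :: "'a form \<Rightarrow> 'a form" where
  "dual (Pos a) = Neg a"
| "dual (Neg a) = Pos a"
| "dual Verum = Falsum"
| "dual Falsum = Verum"
| "dual (Conj A B) = Disj (dual A) (dual B)"
| "dual (Disj A B) = Conj (dual A) (dual B)"

fun contractible :: "'a form \<Rightarrow> bool" where
  "contractible (Pos a) = True"
| "contractible (Neg a) = True"
| "contractible (Conj A B) = True"
| "contractible Verum = False"
| "contractible Falsum = False"
| "contractible (Disj A B) = False"

type_synonym 'a sequent = "'a form multiset"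

text \<open>There is no weakening rule, neither explicitly nor hidden in the axioms.\<close>

inductive LK_star :: "'a sequent \<Rightarrow> bool" where
  ax: "LK_star {#Pos a, Neg a#}"
| verum: "LK_star {#Verum#}"
| disj: "LK_star (\<Gamma> + {#A, B#}) \<Longrightarrow> LK_star (\<Gamma> + {#Disj A B#})"
| disj0: "LK_star (\<Gamma> + {#A#}) \<Longrightarrow> LK_star (\<Gamma> + {#Disj A B#})"
| disj1: "LK_star (\<Gamma> + {#B#}) \<Longrightarrow> LK_star (\<Gamma> + {#Disj A B#})"
| conj: "LK_star (\<Gamma> + {#A#}) \<Longrightarrow> LK_star (\<Delta> + {#B#}) \<Longrightarrow> LK_star (\<Gamma> + \<Delta> + {#Conj A B#})"
| mix: "LK_star \<Gamma> \<Longrightarrow> LK_star \<Delta> \<Longrightarrow> LK_star (\<Gamma> + \<Delta>)"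
| contraction: "LK_star (\<Gamma> + {#C, C#}) \<Longrightarrow> contractible C \<Longrightarrow> LK_star (\<Gamma> + {#C#})"

inductive LK_star_cut :: "'a sequent \<Rightarrow> bool" where
  ax: "LK_star_cut {#Pos a, Neg a#}"
| verum: "LK_star_cut {#Verum#}"
| disj: "LK_star_cut (\<Gamma> + {#A, B#}) \<Longrightarrow> LK_star_cut (\<Gamma> + {#Disj A B#})"
| disj0: "LK_star_cut (\<Gamma> + {#A#}) \<Longrightarrow> LK_star_cut (\<Gamma> + {#Disj A B#})"
| disj1: "LK_star_cut (\<Gamma> + {#B#}) \<Longrightarrow> LK_star_cut (\<Gamma> + {#Disj A B#})"
| conj: "LK_star_cut (\<Gamma> + {#A#}) \<Longrightarrow> LK_star_cut (\<Delta> + {#B#}) \<Longrightarrow>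
    LK_star_cut (\<Gamma> + \<Delta> + {#Conj A B#})"
| mix: "LK_star_cut \<Gamma> \<Longrightarrow> LK_star_cut \<Delta> \<Longrightarrow> LK_star_cut (\<Gamma> + \<Delta>)"
| contraction: "LK_star_cut (\<Gamma> + {#C, C#}) \<Longrightarrow> contractible C \<Longrightarrow> LK_star_cut (\<Gamma> + {#C#})"
| cut: "LK_star_cut (\<Gamma> + {#A#}) \<Longrightarrow> LK_star_cut (\<Delta> + {#dual A#}) \<Longrightarrow> LK_star_cut (\<Gamma> + \<Delta>)"

end

theory Submission
  imports Defs
begin

text \<open>
  Cut need not be eliminated step by step. The calculus with cut is sound for Boolean
  valuations, where a sequent is read as a disjunction, so it is enough to show that every valid
  sequent has a sub-multiset provable without cut (\<open>valid_imp_has_provable_sub\<close>).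

  That is shown by root-first proof search. The decompositions of \<open>Disj A B\<close> into \<open>A, B\<close> and of
  \<open>Conj A B\<close> into \<open>A\<close> and \<open>B\<close> (with the same context) preserve validity and make the
  sequent smaller, and a valid sequent of literals contains an axiom. Coming back down, the
  sub-multiset that is proved may have lost some of the parts of the decomposed formula: for a
  disjunction with one disjunct lost, \<open>disj0\<close> and \<open>disj1\<close> make up for this; if a conjunct or both
  disjuncts are lost, then what is left lies in the context of the decomposed formula and serves
  as it is.

  The delicate point is the conjunction rule, which splits its context, so that the formulae used
  on both sides must be contracted, while disjunctions and constants cannot be. The order of
  decomposition resolves this: \<open>Verum\<close> is provable on its own, \<open>Falsum\<close> can be dropped without
  losing validity, and conjunctions are treated only when no disjunction and no constant is left,
  so that the whole context is contractible.
\<close>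

section \<open>Validity and soundness\<close>

primrec holds :: "('a \<Rightarrow> bool) \<Rightarrow> 'a form \<Rightarrow> bool" where
  "holds v (Pos a) = v a"
| "holds v (Neg a) = (\<not> v a)"
| "holds v Verum = True"
| "holds v Falsum = False"
| "holds v (Conj A B) = (holds v A \<and> holds v B)"
| "holds v (Disj A B) = (holds v A \<or> holds v B)"

definition valid :: "'a sequent \<Rightarrow> bool" where
  "valid \<Gamma> \<longleftrightarrow> (\<forall>v. \<exists>A \<in># \<Gamma>. holds v A)"

lemma holds_dual: "holds v (dual A) \<longleftrightarrow> \<not> holds v A"
  by (induction A) auto

lemma LK_star_cut_sound: "LK_star_cut \<Gamma> \<Longrightarrow> valid \<Gamma>"
proof (induction rule: LK_star_cut.induct)
  case (cut \<Gamma> A \<Delta>)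
  then show ?case
    by (simp add: valid_def holds_dual) blast
qed (simp add: valid_def; blast)+

section \<open>Provable sub-multisets\<close>

definition has_provable_sub :: "'a sequent \<Rightarrow> bool" where
  "has_provable_sub \<Gamma> \<longleftrightarrow> (\<exists>\<Gamma>'. \<Gamma>' \<subseteq># \<Gamma> \<and> LK_star \<Gamma>')"

lemma has_provable_subI: "LK_star \<Gamma>' \<Longrightarrow> \<Gamma>' \<subseteq># \<Gamma> \<Longrightarrow> has_provable_sub \<Gamma>"
  by (auto simp: has_provable_sub_def)

lemma has_provable_sub_mono:
  "has_provable_sub \<Delta> \<Longrightarrow> \<Delta> \<subseteq># \<Gamma> \<Longrightarrow> has_provable_sub \<Gamma>"
  by (meson has_provable_sub_def subset_mset.order_trans)

lemma subseteq_add_mset_cases: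
  assumes "M \<subseteq># add_mset x N"
  obtains "M \<subseteq># N" | M' where "M = add_mset x M'" "M' \<subseteq># N"
proof (cases "x \<in># M")
  case True
  then obtain M' where "M = add_mset x M'"
    by (metis insert_DiffM)
  then show ?thesis
    using assms that(2) by simp
next
  case False
  then show ?thesis
    using assms that(1) by (metis diff_single_trivial subset_eq_diff_conv add_mset_add_single)
qed

lemma has_provable_sub_disj:
  assumes "has_provable_sub (add_mset A (add_mset B \<Delta>))"
  shows "has_provable_sub (add_mset (Disj A B) \<Delta>)"
proof -
  obtain \<Gamma>' where prov: "LK_star \<Gamma>'" and sub: "\<Gamma>' \<subseteq># add_mset A (add_mset B \<Delta>)"
    using assms by (auto simp: has_provable_sub_def)
  \<comment> \<open>the four cases: none, only \<open>B\<close>, only \<open>A\<close>, or both of the disjuncts survive\<close>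
  from sub show ?thesis
  proof (cases rule: subseteq_add_mset_cases)
    case 1
    then show ?thesis
    proof (cases rule: subseteq_add_mset_cases)
      case 1
      then have "\<Gamma>' \<subseteq># add_mset (Disj A B) \<Delta>"
        by (simp add: subset_mset.add_increasing subset_mset.order_trans)
      with prov show ?thesis
        by (rule has_provable_subI)
    next
      case (2 \<Delta>')
      with prov LK_star.disj1[of \<Delta>' B A] show ?thesis
        by (intro has_provable_subI[of "add_mset (Disj A B) \<Delta>'"]) auto
    qed
  next
    case (2 \<Delta>0)
    from 2(2) show ?thesis
    proof (cases rule: subseteq_add_mset_cases)
      case 1
      with prov 2 LK_star.disj0[of \<Delta>0 A B] show ?thesis
        by (intro has_provable_subI[of "add_mset (Disj A B) \<Delta>0"]) auto
    next
      case (2 \<Delta>')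
      with prov \<open>\<Gamma>' = add_mset A \<Delta>0\<close> LK_star.disj[of \<Delta>' A B] show ?thesis
        by (intro has_provable_subI[of "add_mset (Disj A B) \<Delta>'"]) (auto simp: add_mset_commute)
    qed
  qed
qed

lemma contract_multiset:
  assumes "LK_star (\<Sigma> + \<Sigma> + \<Gamma>)" "\<forall>C \<in># \<Sigma>. contractible C"
  shows "LK_star (\<Sigma> + \<Gamma>)"
  using assms
proof (induction \<Sigma> arbitrary: \<Gamma>)
  case (add C \<Sigma>)
  then have "LK_star (\<Sigma> + \<Sigma> + \<Gamma> + {#C, C#})"
    by (simp add: ac_simps)
  then have "LK_star (\<Sigma> + \<Sigma> + \<Gamma> + {#C#})"
    using add.prems by (intro LK_star.contraction) auto
  then show ?case
    using add.IH[of "add_mset C \<Gamma>"] add.prems by simp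
qed simp

text \<open>
  Each premise may use any part of the context \<open>\<Delta>\<close>, so formulae may occur twice in the conclusion. Only the overlap of the
  two portions of \<open>\<Delta>\<close> is contracted, which leaves their union as multisets, again inside \<open>\<Delta>\<close>.
\<close>

lemma has_provable_sub_conj:
  assumes A: "has_provable_sub (add_mset A \<Delta>)" and B: "has_provable_sub (add_mset B \<Delta>)"
    and contr: "\<forall>C \<in># \<Delta>. contractible C"
  shows "has_provable_sub (add_mset (Conj A B) \<Delta>)"
proof (cases "has_provable_sub \<Delta>")
  case True
  then show ?thesis
    by (rule has_provable_sub_mono) simp
next
  case False
  obtain \<Delta>1 where \<Delta>1: "LK_star (add_mset A \<Delta>1)" "\<Delta>1 \<subseteq># \<Delta>"
    using A False by (metis has_provable_sub_def subseteq_add_mset_cases)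
  obtain \<Delta>2 where \<Delta>2: "LK_star (add_mset B \<Delta>2)" "\<Delta>2 \<subseteq># \<Delta>"
    using B False by (metis has_provable_sub_def subseteq_add_mset_cases)
  let ?\<Sigma> = "\<Delta>1 \<inter># \<Delta>2"
  let ?R = "(\<Delta>1 - \<Delta>2) + (\<Delta>2 - \<Delta>1)"
  have "LK_star (\<Delta>1 + \<Delta>2 + {#Conj A B#})"
    using \<Delta>1 \<Delta>2 by (intro LK_star.conj) auto
  moreover have "\<Delta>1 + \<Delta>2 + {#Conj A B#} = ?\<Sigma> + ?\<Sigma> + add_mset (Conj A B) ?R"
    by (rule multiset_eqI) (simp add: min_def max_def)
  moreover have "\<forall>C \<in># ?\<Sigma>. contractible C"
    using contr \<Delta>1(2) by (auto dest: mset_subset_eqD)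
  ultimately have "LK_star (?\<Sigma> + add_mset (Conj A B) ?R)"
    using contract_multiset by metis
  moreover have "?\<Sigma> + add_mset (Conj A B) ?R = add_mset (Conj A B) (\<Delta>1 \<union># \<Delta>2)"
    by (rule multiset_eqI) (simp add: min_def max_def)
  ultimately show ?thesis
    using \<Delta>1(2) \<Delta>2(2) by (intro has_provable_subI) auto
qed

section \<open>Completeness up to sub-multisets\<close>

text \<open>
  If a sequent of literals has no complementary pair, then it is falsified by the valuation that
  makes an atom true exactly when its negation occurs.
\<close>

lemma valid_literals_complementary:
  assumes "valid \<Gamma>" and "\<forall>A \<in># \<Gamma>. \<exists>a. A = Pos a \<or> A = Neg a"
  obtains a where "Pos a \<in># \<Gamma>" "Neg a \<in># \<Gamma>"
proof -
  obtain A where "A \<in># \<Gamma>" "holds (\<lambda>a. Neg a \<in># \<Gamma>) A"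
    using assms(1) unfolding valid_def by blast
  then show ?thesis
    using assms(2) that by fastforce
qed

text \<open>
  The measure of the proof search. The plain size of a constant is 0, so it would not decrease
  when \<open>Falsum\<close> is dropped; and size plus 1 would not decrease when a disjunction is replaced by
  both disjuncts.
\<close>

definition weight :: "'a form \<Rightarrow> nat" where
  "weight A = 2 * size A + 1"

lemma weight_simps:
  "weight (Conj A B) = weight A + weight B + 1"
  "weight (Disj A B) = weight A + weight B + 1"
  "0 < weight A"
  by (simp_all add: weight_def)

theorem valid_imp_has_provable_sub: "valid \<Gamma> \<Longrightarrow> has_provable_sub \<Gamma>"
proof (induction "\<Sum>A \<in># \<Gamma>. weight A" arbitrary: \<Gamma> rule: less_induct)
  case less
  consider (verum) "Verum \<in># \<Gamma>"
    | (falsum) "Falsum \<in># \<Gamma>"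
    | (disj) A B where "Disj A B \<in># \<Gamma>"
    | (conj) A B where "Conj A B \<in># \<Gamma>" "\<forall>C \<in># \<Gamma>. contractible C"
    | (literals) "\<forall>A \<in># \<Gamma>. \<exists>a. A = Pos a \<or> A = Neg a"
  proof -
    have "A = Verum \<or> A = Falsum \<or> (\<exists>B C. A = Disj B C) \<or> (\<exists>B C. A = Conj B C)
        \<or> (\<exists>a. A = Pos a \<or> A = Neg a)" for A :: "'a form"
      by (cases A) auto
    moreover have "contractible A \<longleftrightarrow> A \<noteq> Verum \<and> A \<noteq> Falsum \<and> (\<forall>B C. A \<noteq> Disj B C)"
      for A :: "'a form"
      by (cases A) auto
    ultimately show thesis
      using that by metis
  qed
  then show ?case
  proof cases
    case verum
    then show ?thesis
      using LK_star.verum by (intro has_provable_subI) auto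
  next
    case falsum
    then obtain \<Delta> where \<Gamma>: "\<Gamma> = add_mset Falsum \<Delta>"
      by (metis insert_DiffM)
    with less have "has_provable_sub \<Delta>"
      by (auto simp: valid_def weight_simps)
    then show ?thesis
      by (rule has_provable_sub_mono) (simp add: \<Gamma>)
  next
    case (disj A B)
    then obtain \<Delta> where \<Gamma>: "\<Gamma> = add_mset (Disj A B) \<Delta>"
      by (metis insert_DiffM)
    have "valid (add_mset A (add_mset B \<Delta>))"
      using less.prems by (fastforce simp: valid_def \<Gamma>)
    then have "has_provable_sub (add_mset A (add_mset B \<Delta>))"
      by (intro less.hyps) (simp_all add: \<Gamma> weight_simps)
    then show ?thesis
      unfolding \<Gamma> by (rule has_provable_sub_disj)
  next
    case (conj A B)
    then obtain \<Delta> where \<Gamma>: "\<Gamma> = add_mset (Conj A B) \<Delta>"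
      by (metis insert_DiffM)
    have "valid (add_mset A \<Delta>)" "valid (add_mset B \<Delta>)"
      using less.prems by (fastforce simp: valid_def \<Gamma>)+
    then have "has_provable_sub (add_mset A \<Delta>)" "has_provable_sub (add_mset B \<Delta>)"
      by (auto intro!: less.hyps simp: \<Gamma> weight_simps)
    then show ?thesis
      unfolding \<Gamma> using conj(2) by (intro has_provable_sub_conj) (auto simp: \<Gamma>)
  next
    case literals
    with less.prems obtain a where "Pos a \<in># \<Gamma>" "Neg a \<in># \<Gamma>"
      by (rule valid_literals_complementary)
    then have "{#Pos a, Neg a#} \<subseteq># \<Gamma>"
      by (metis form.distinct(1) insert_DiffM insert_noteq_member mset_subset_eq_add_mset_cancel
          single_subset_iff)
    with LK_star.ax show ?thesis
      by (rule has_provable_subI)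
  qed
qed

theorem proposition52:
  fixes \<Gamma> :: "'a sequent"
  assumes "LK_star_cut \<Gamma>"
  shows "\<exists>\<Gamma>'. \<Gamma>' \<subseteq># \<Gamma> \<and> LK_star \<Gamma>'"
  using valid_imp_has_provable_sub[OF LK_star_cut_sound[OF assms]]
  by (simp add: has_provable_sub_def)

end
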